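(* Let $H\ge1$ be an integer, and for integers $t\ge1$ let $\alpha_t=\frac{H+1}{H+t}$. For $1\le i\le t$ define $\alpha_t^i=\alpha_i\prod_{j=i+1}^t(1-\alpha_j)$ (an empty product equals $1$). Then: (a) for every $t\ge1$, $\displaystyle\frac{1}{\sqrt t}\le\sum_{i=1}^t\frac{\alpha_t^i}{\sqrt i}\le\frac{2}{\sqrt t}$; (b) for every $t\ge1$, $\displaystyle\max_{i\in\{1,\dots,t\}}\alpha_t^i\le\frac{2H}{t}$ and $\displaystyle\sum_{i=1}^t(\alpha_t^i)^2\le\frac{2H}{t}$; (c) for every $i\ge1$, $\displaystyle\sum_{t=i}^\infty\alpha_t^i=1+\frac1H$. *)

theory Defs
  imports Complex_Main
begin

definition alpha :: "nat \<Rightarrow> nat \<Rightarrow> real" where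
  "alpha H t = (real H + 1) / (real H + real t)"

(* "weight H t i" is the quantity usually written alpha_t^i; the superscript is an index,
   not a power. It is meant for 1 <= i <= t. *)
definition weight :: "nat \<Rightarrow> nat \<Rightarrow> nat \<Rightarrow> real" where
  "weight H t i = alpha H i * (\<Prod>j = i+1..t. 1 - alpha H j)"

end

theory Submission
  imports Defs
begin

text \<open>
  Everything rests on the recursion
  \<open>weight H (t + 1) i = (1 - alpha H (t + 1)) * weight H t i\<close> and on
  \<open>alpha H 1 = 1\<close>, which makes the weights sum to one. So the sum in (a) is a weighted mean of numbers
  \<open>1 / sqrt i \<ge> 1 / sqrt t\<close>; its upper bound is an induction on \<open>t\<close> whose step reduces to
  \<open>2 * sqrt t * sqrt (t + 1) \<le> 2 * t + 1\<close>. For part (b), each weight is at most the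
  last one, \<open>alpha H t\<close>, and the sum of squares is at most the maximum times the sum. In part (c) the
  series telescopes: its tail from \<open>t\<close> on is \<open>weight H t i * (H + t) / H\<close>.
\<close>

lemma one_minus_alpha:
  assumes "H \<ge> 1"
  shows "1 - alpha H (Suc t) = real t / (real H + real t + 1)"
  using assms by (simp add: alpha_def field_simps)

lemma alpha_nonneg: "0 \<le> alpha H t"
  by (simp add: alpha_def)

lemma weight_self [simp]: "weight H t t = alpha H t"
  by (simp add: weight_def)

lemma weight_Suc:
  assumes "i \<le> t"
  shows "weight H (Suc t) i = (1 - alpha H (Suc t)) * weight H t i"
  using assms by (simp add: weight_def)

lemma weight_nonneg:
  assumes "H \<ge> 1" "i \<le> t"
  shows "0 \<le> weight H t i"
  using assms(2)
proof (induction t rule: dec_induct)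
  case base
  then show ?case by (simp add: alpha_nonneg)
next
  case (step n)
  then show ?case using assms(1) by (simp add: weight_Suc one_minus_alpha)
qed

text \<open>The induction closes because the numerator of \<open>alpha\<close> does not depend on
  its index: in \<open>(1 - alpha H (n + 1)) * alpha H n\<close> the two denominators can be
  swapped, leaving \<open>alpha H (n + 1)\<close> times \<open>n / (H + n) \<le> 1\<close>.\<close>

lemma weight_le_alpha:
  assumes "H \<ge> 1" "i \<le> t"
  shows "weight H t i \<le> alpha H t"
  using assms(2)
proof (induction t rule: dec_induct)
  case base
  then show ?case by simp
next
  case (step n)
  have "weight H (Suc n) i \<le> real n / (real H + real n + 1) * alpha H n"
    using step assms(1) by (simp add: weight_Suc one_minus_alpha divide_right_mono mult_left_mono)
  also have "\<dots> = real n / (real H + real n) * alpha H (Suc n)"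
    by (simp add: alpha_def algebra_simps)
  also have "\<dots> \<le> alpha H (Suc n)"
    using assms(1) by (intro mult_left_le_one_le) (auto simp: alpha_nonneg)
  finally show ?case .
qed

text \<open>Passing from \<open>t\<close> to \<open>t + 1\<close> scales all old weights by one
  common factor. A general \<open>f\<close> serves both uses: \<open>f = 1\<close> for the total
  weight and \<open>f i = 1 / sqrt i\<close> for part (a).\<close>

lemma sum_weight_Suc:
  "(\<Sum>i = 1..Suc t. weight H (Suc t) i * f i)
     = (1 - alpha H (Suc t)) * (\<Sum>i = 1..t. weight H t i * f i) + alpha H (Suc t) * f (Suc t)"
proof -
  have "(\<Sum>i = 1..t. weight H (Suc t) i * f i)
      = (1 - alpha H (Suc t)) * (\<Sum>i = 1..t. weight H t i * f i)"
    unfolding sum_distrib_left by (intro sum.cong) (auto simp: weight_Suc)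
  then show ?thesis by simp
qed

lemma sum_weight:
  assumes "H \<ge> 1" "t \<ge> 1"
  shows "(\<Sum>i = 1..t. weight H t i) = 1"
  using assms(2)
proof (induction t rule: dec_induct)
  case base
  then show ?case by (simp add: alpha_def)
next
  case (step n)
  then show ?case using sum_weight_Suc[of H n "\<lambda>_. 1"] by simp
qed

lemma sum_weight_inverse_sqrt_ge:
  assumes "H \<ge> 1" "t \<ge> 1"
  shows "1 / sqrt (real t) \<le> (\<Sum>i = 1..t. weight H t i / sqrt (real i))"
proof -
  have "1 / sqrt (real t) = (\<Sum>i = 1..t. weight H t i / sqrt (real t))"
    using sum_weight[OF assms] by (simp flip: sum_divide_distrib)
  also have "\<dots> \<le> (\<Sum>i = 1..t. weight H t i / sqrt (real i))"
    using assms by (intro sum_mono divide_left_mono) (auto simp: weight_nonneg)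
  finally show ?thesis .
qed

lemma sum_weight_inverse_sqrt_le:
  assumes "H \<ge> 1" "t \<ge> 1"
  shows "(\<Sum>i = 1..t. weight H t i / sqrt (real i)) \<le> 2 / sqrt (real t)"
  using assms(2)
proof (induction t rule: dec_induct)
  case base
  then show ?case by (simp add: alpha_def)
next
  case (step n)
  define a b h where "a = sqrt (real n)" and "b = sqrt (real (Suc n))" and "h = real H"
  have pos: "a > 0" "b > 0" "h \<ge> 1"
    using step assms(1) by (auto simp: a_def b_def h_def)
  have sq: "a * a = real n" "b * b = real n + 1"
    by (auto simp: a_def b_def)
  have "0 \<le> (a - b) * (a - b)" by simp
  then have "2 * a * b \<le> 2 * real n + 1"
    using sq by (simp add: algebra_simps)
  \<comment> \<open>Adding \<open>h + 1\<close> leaves a slack of \<open>h\<close>. After division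
    by \<open>(h + n + 1) * b\<close> this is exactly the bound \<open>2 / b\<close>.\<close>
  then have key: "2 * a * b + (h + 1) \<le> 2 * (h + real n + 1)"
    using pos by simp
  have "(\<Sum>i = 1..Suc n. weight H (Suc n) i / sqrt (real i))
      = (1 - alpha H (Suc n)) * (\<Sum>i = 1..n. weight H n i / sqrt (real i)) + alpha H (Suc n) / b"
    using sum_weight_Suc[of H n "\<lambda>i. 1 / sqrt (real i)"] by (simp add: b_def)
  also have "\<dots> \<le> (1 - alpha H (Suc n)) * (2 / a) + alpha H (Suc n) / b"
    using step assms(1)
    by (intro add_right_mono mult_left_mono) (auto simp: one_minus_alpha a_def)
  also have "\<dots> = (2 * a * b + (h + 1)) / (h + real n + 1) / b"
  proof -
    have eqs: "1 - alpha H (Suc n) = a * a / (h + real n + 1)"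
         "alpha H (Suc n) = (h + 1) / (h + real n + 1)"
      by (simp_all only: one_minus_alpha[OF assms(1)] h_def sq(1)) (simp add: alpha_def add_ac)
    have "a * a / p * (2 / a) + (h + 1) / p / b = (2 * a * b + (h + 1)) / p / b"
      if "p > 0" for p
    proof -
      have "a * a / p * (2 / a) = 2 * a * b / p / b" using pos by simp
      then show ?thesis by (simp add: add_divide_distrib)
    qed
    from this[of "h + real n + 1"] show ?thesis
      \<comment> \<open>The order matters: \<open>eqs(2)\<close> would rewrite inside the left-hand
        side of \<open>eqs(1)\<close>.\<close>
      unfolding eqs(1) unfolding eqs(2) using pos by simp
  qed
  also have "\<dots> \<le> 2 / b"
    using key pos by (intro divide_right_mono) (auto simp: field_simps)
  finally show ?case by (simp add: b_def)
qed

text \<open>The numerator satisfies \<open>H + 1 \<le> 2 * H\<close> because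
  \<open>H \<ge> 1\<close>, and the denominator is at least \<open>t\<close>.\<close>

lemma alpha_le:
  assumes "H \<ge> 1" "t \<ge> 1"
  shows "alpha H t \<le> 2 * real H / real t"
  unfolding alpha_def using assms by (intro frac_le) auto

lemma sum_weight_squared_le:
  assumes "H \<ge> 1" "t \<ge> 1"
  shows "(\<Sum>i = 1..t. (weight H t i)\<^sup>2) \<le> alpha H t"
proof -
  have "(\<Sum>i = 1..t. (weight H t i)\<^sup>2) \<le> (\<Sum>i = 1..t. alpha H t * weight H t i)"
    unfolding power2_eq_square using assms
    by (intro sum_mono mult_right_mono) (auto simp: weight_nonneg weight_le_alpha)
  also have "\<dots> = alpha H t"
    using sum_weight[OF assms] by (simp flip: sum_distrib_left)
  finally show ?thesis .
qed

lemma weight_sums: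
  assumes "H \<ge> 1" "i \<ge> 1"
  shows "(\<lambda>n. weight H (i + n) i) sums (1 + 1 / real H)"
proof -
  define c where "c n = weight H (i + n) i * (real H + real (i + n)) / real H" for n
  \<comment> \<open>The factor \<open>H + i + n + 1\<close> in \<open>c (Suc n)\<close> cancels the
    denominator of \<open>1 - alpha H (i + n + 1)\<close>. Hence \<open>c n\<close> and
    \<open>c (Suc n)\<close> differ by \<open>H / H\<close> times the weight.\<close>
  have c_Suc_eq: "c (Suc n) = weight H (i + n) i * real (i + n) / real H" for n
    using assms(1) by (simp add: c_def weight_Suc one_minus_alpha add_ac)
  have diff: "c n - c (Suc n) = weight H (i + n) i" for n
    unfolding c_Suc_eq using assms(1) by (simp add: c_def field_simps)
  have c0: "c 0 = 1 + 1 / real H"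
  proof -
    have "real H + real i \<noteq> 0" using assms by simp
    then have "c 0 = (real H + 1) / real H" by (simp add: c_def alpha_def)
    then show ?thesis using assms(1) by (simp add: add_divide_distrib)
  qed
  have nonneg: "0 \<le> c n" for n
    using assms by (simp add: c_def weight_nonneg)
  have c_Suc: "(real H + real (i + n)) * c (Suc n) = real (i + n) * c n" for n
    unfolding c_Suc_eq by (simp add: c_def)
  \<comment> \<open>The product \<open>(i + n) * c n\<close> is nonincreasing, since
    \<open>i + n + 1 \<le> H + i + n\<close>. So \<open>c n\<close> is O(1/n), enough for the limit
    0.\<close>
  have "real (i + n) * c n \<le> real i * c 0" for n
  proof (induction n)
    case (Suc n)
    have "real (i + Suc n) * c (Suc n) \<le> (real H + real (i + n)) * c (Suc n)"
      using assms(1) nonneg by (intro mult_right_mono) auto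
    then show ?case using Suc c_Suc by simp
  qed simp
  then have le: "c n \<le> real i * c 0 / real (i + n)" for n
    using assms(2) by (simp add: pos_le_divide_eq mult.commute)
  have upper: "(\<lambda>n. real i * c 0 / real (i + n)) \<longlonglongrightarrow> 0"
    using LIMSEQ_ignore_initial_segment[OF lim_const_over_n[of "real i * c 0"], of i]
    by (simp only: add.commute)
  have "c \<longlonglongrightarrow> 0"
    by (rule tendsto_sandwich[OF always_eventually always_eventually tendsto_const upper])
      (simp_all only: nonneg le simp_thms)
  from telescope_sums'[OF this] show ?thesis
    by (simp only: diff c0 diff_zero)
qed

theorem lemma10:
  fixes H :: nat
  assumes "H \<ge> 1"
  shows "(\<forall>t::nat. t \<ge> 1 \<longrightarrow>
            1 / sqrt (real t) \<le> (\<Sum>i = 1..t. weight H t i / sqrt (real i)) \<and>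
            (\<Sum>i = 1..t. weight H t i / sqrt (real i)) \<le> 2 / sqrt (real t)) \<and>
         (\<forall>t::nat. t \<ge> 1 \<longrightarrow>
            Max ((\<lambda>i. weight H t i) ` {1..t}) \<le> 2 * real H / real t \<and>
            (\<Sum>i = 1..t. (weight H t i)\<^sup>2) \<le> 2 * real H / real t) \<and>
         (\<forall>i::nat. i \<ge> 1 \<longrightarrow>
            (\<lambda>n. weight H (i + n) i) sums (1 + 1 / real H))"
proof (intro conjI allI impI)
  fix t :: nat
  assume t: "t \<ge> 1"
  show "1 / sqrt (real t) \<le> (\<Sum>i = 1..t. weight H t i / sqrt (real i))"
    by (rule sum_weight_inverse_sqrt_ge[OF assms t])
  show "(\<Sum>i = 1..t. weight H t i / sqrt (real i)) \<le> 2 / sqrt (real t)"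
    by (rule sum_weight_inverse_sqrt_le[OF assms t])
  have "Max ((\<lambda>i. weight H t i) ` {1..t}) \<le> alpha H t"
    using t assms by (subst Max_le_iff) (auto simp: weight_le_alpha)
  then show "Max ((\<lambda>i. weight H t i) ` {1..t}) \<le> 2 * real H / real t"
    using alpha_le[OF assms t] by linarith
  show "(\<Sum>i = 1..t. (weight H t i)\<^sup>2) \<le> 2 * real H / real t"
    using sum_weight_squared_le[OF assms t] alpha_le[OF assms t] by linarith
next
  fix i :: nat
  assume "i \<ge> 1"
  then show "(\<lambda>n. weight H (i + n) i) sums (1 + 1 / real H)"
    by (rule weight_sums[OF assms])
qed

end
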